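(* Let $\sigma>1$ and let $a<b$ be real numbers. Then $\mathcal E_{\{\sigma\}}([a,b])=\mathscr E_{\{\sigma\}}([a,b])$ (Roumieu case) and $\mathcal E_{(\sigma)}([a,b])=\mathscr E_{(\sigma)}([a,b])$ (Beurling case). In both cases the equality holds as locally convex spaces, i.e. the two spaces coincide as sets and carry the same locally convex topology.
   Context: For $\tau>0$, $\sigma>1$ put $M_0^{\tau,\sigma}=1$ and $M_n^{\tau,\sigma}=n^{\tau n^\sigma}$ for $n\in\mathbb N=\{1,2,\dots\}$; $\mathbb N_0=\mathbb N\cup\{0\}$. $C^\infty([a,b])$ is the space of smooth functions on $[a,b]$ (one-sided derivatives at the endpoints). For $h,\tau>0$ and $\sigma>1$ let $\mathcal E_{h,\tau,\sigma}([a,b])$ be the Banach space of all $f\in C^\infty([a,b])$ with $$\|f\|_{h,\tau,\sigma}=\sup_{n\in\mathbb N_0}\frac{\max_{x\in[a,b]}|f^{(n)}(x)|}{h^{n^\sigma}M_n^{\tau,\sigma}}<\infty .$$ Spaces without the factor $h^{n^\sigma}$: $$\mathcal E_{\{\sigma\}}([a,b])=\bigcup_{\tau>0}\mathcal E_{1,\tau,\sigma}([a,b]),\qquad \mathcal E_{(\sigma)}([a,b])=\bigcap_{\tau>0}\mathcal E_{1,\tau,\sigma}([a,b]).$$ Spaces with the factor $h^{n^\sigma}$: $$\mathscr E_{\{\sigma\}}([a,b])=\bigcup_{\tau>0}\bigcup_{h>0}\mathcal E_{h,\tau,\sigma}([a,b]),\qquad \mathscr E_{(\sigma)}([a,b])=\bigcap_{\tau>0}\bigcap_{h>0}\mathcal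 E_{h,\tau,\sigma}([a,b]).$$ The unions are endowed with the locally convex inductive limit topology (the finest locally convex topology making all inclusions of the Banach spaces in the union continuous). The intersections are endowed with the projective limit topology (the coarsest topology making all inclusions into the Banach spaces continuous, i.e. the topology generated by the corresponding norms). *)

theory Defs
  imports "HOL-Analysis.Analysis"
begin

section \<open>Smooth functions on a compact interval\<close>

text \<open>
  A function on \<open>[a,b]\<close> is represented by the total function that vanishes outside \<open>[a,b]\<close>,
  so that equality of functions is equality on \<open>[a,b]\<close> and the pointwise operations
  are the vector space operations.  The scalar field \<open>'k\<close> is \<open>\<real>\<close> or \<open>\<complex>\<close>.
\<close>

primrec nderiv :: "real \<Rightarrow> real \<Rightarrow> nat \<Rightarrow> (real \<Rightarrow> 'k) \<Rightarrow> real \<Rightarrow> 'k::real_normed_field" where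
  "nderiv a b 0 f = f"
| "nderiv a b (Suc n) f =
     (\<lambda>x. if x \<in> {a..b} then vector_derivative (nderiv a b n f) (at x within {a..b}) else 0)"

definition smooth_fun :: "real \<Rightarrow> real \<Rightarrow> (real \<Rightarrow> 'k::real_normed_field) set" where
  "smooth_fun a b =
     {f. (\<forall>x. x \<notin> {a..b} \<longrightarrow> f x = 0) \<and> (\<forall>n. nderiv a b n f differentiable_on {a..b})}"


section \<open>The Banach spaces\<close>

text \<open>The case distinction is needed because \<open>0 powr 0 = 0\<close>.\<close>

definition M_seq :: "real \<Rightarrow> real \<Rightarrow> nat \<Rightarrow> real" where
  "M_seq \<tau> \<sigma> n = (if n = 0 then 1 else real n powr (\<tau> * real n powr \<sigma>))"

definition deriv_quot :: "real \<Rightarrow> real \<Rightarrow> real \<Rightarrow> real \<Rightarrow> real \<Rightarrow> (real \<Rightarrow> 'k::real_normed_field) \<Rightarrow> nat \<Rightarrow> real" where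
  "deriv_quot h \<tau> \<sigma> a b f n =
     (SUP x\<in>{a..b}. norm (nderiv a b n f x)) / (h powr (real n powr \<sigma>) * M_seq \<tau> \<sigma> n)"

definition E_space :: "real \<Rightarrow> real \<Rightarrow> real \<Rightarrow> real \<Rightarrow> real \<Rightarrow> (real \<Rightarrow> 'k::real_normed_field) set" where
  "E_space h \<tau> \<sigma> a b = {f \<in> smooth_fun a b. bdd_above (range (deriv_quot h \<tau> \<sigma> a b f))}"

text \<open>The value \<open>0\<close> outside the space is a dummy: the real-valued supremum is unspecified there.\<close>

definition E_norm :: "real \<Rightarrow> real \<Rightarrow> real \<Rightarrow> real \<Rightarrow> real \<Rightarrow> (real \<Rightarrow> 'k::real_normed_field) \<Rightarrow> real" where
  "E_norm h \<tau> \<sigma> a b f =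
     (if f \<in> E_space h \<tau> \<sigma> a b then (SUP n. deriv_quot h \<tau> \<sigma> a b f n) else 0)"

definition E_topology :: "real \<Rightarrow> real \<Rightarrow> real \<Rightarrow> real \<Rightarrow> real \<Rightarrow> (real \<Rightarrow> 'k::real_normed_field) topology" where
  "E_topology h \<tau> \<sigma> a b =
     Metric_space.mtopology (E_space h \<tau> \<sigma> a b) (\<lambda>f g. E_norm h \<tau> \<sigma> a b (\<lambda>x. f x - g x))"


section \<open>Locally convex topologies on spaces of functions\<close>

text \<open>
  The underlying vector space is \<open>topspace T\<close>; that it is a linear subspace is implied by
  \<open>0 \<in> topspace T\<close> and the two continuity conditions.
\<close>

definition convex_fun_set :: "('a \<Rightarrow> 'k::real_normed_field) set \<Rightarrow> bool" where
  "convex_fun_set C \<longleftrightarrow>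
     (\<forall>f\<in>C. \<forall>g\<in>C. \<forall>t\<in>{0..1::real}. (\<lambda>x. (1 - t) *\<^sub>R f x + t *\<^sub>R g x) \<in> C)"

definition locally_convex_topology :: "('a \<Rightarrow> 'k::real_normed_field) topology \<Rightarrow> bool" where
  "locally_convex_topology T \<longleftrightarrow>
     (\<lambda>x. 0) \<in> topspace T \<and>
     continuous_map (prod_topology T T) T (\<lambda>(f, g). (\<lambda>x. f x + g x)) \<and>
     continuous_map (prod_topology euclidean T) T (\<lambda>(c, f). (\<lambda>x. c * f x)) \<and>
     (\<forall>U. openin T U \<and> (\<lambda>x. 0) \<in> U \<longrightarrow>
        (\<exists>C. openin T C \<and> (\<lambda>x. 0) \<in> C \<and> C \<subseteq> U \<and> convex_fun_set C))"

text \<open>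
  The finest locally convex topology on \<open>V\<close> making all inclusions of the members of the family
  \<open>\<S>\<close> continuous, constructed as the supremum of all such topologies; see
  \<open>inductive_limit_topology_finest\<close>.
\<close>

definition inductive_limit_candidate ::
    "('a \<Rightarrow> 'k::real_normed_field) set \<Rightarrow> ('a \<Rightarrow> 'k) topology set \<Rightarrow> ('a \<Rightarrow> 'k) topology \<Rightarrow> bool" where
  "inductive_limit_candidate V \<S> T \<longleftrightarrow>
     topspace T = V \<and> locally_convex_topology T \<and> (\<forall>S\<in>\<S>. continuous_map S T (\<lambda>f. f))"

definition inductive_limit_topology ::
    "('a \<Rightarrow> 'k::real_normed_field) set \<Rightarrow> ('a \<Rightarrow> 'k) topology set \<Rightarrow> ('a \<Rightarrow> 'k) topology" where
  "inductive_limit_topology V \<S> =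
     topology_generated_by {U. \<exists>T. inductive_limit_candidate V \<S> T \<and> openin T U}"

text \<open>The coarsest topology on \<open>V\<close> making all inclusions into the members of \<open>\<S>\<close> continuous;
  see \<open>projective_limit_topology_coarsest\<close>.\<close>

definition projective_limit_topology ::
    "('a \<Rightarrow> 'k) set \<Rightarrow> ('a \<Rightarrow> 'k) topology set \<Rightarrow> ('a \<Rightarrow> 'k) topology" where
  "projective_limit_topology V \<S> = topology_generated_by {V \<inter> U | U. \<exists>S\<in>\<S>. openin S U}"


section \<open>The four spaces\<close>

text \<open>The suffix \<open>h\<close> marks the spaces whose norms carry the factor \<open>h^(n^\<sigma>)\<close>.\<close>

definition roumieu :: "real \<Rightarrow> real \<Rightarrow> real \<Rightarrow> (real \<Rightarrow> 'k::real_normed_field) set" where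
  "roumieu \<sigma> a b = (\<Union>\<tau>\<in>{0<..}. E_space 1 \<tau> \<sigma> a b)"

definition roumieu_topology :: "real \<Rightarrow> real \<Rightarrow> real \<Rightarrow> (real \<Rightarrow> 'k::real_normed_field) topology" where
  "roumieu_topology \<sigma> a b =
     inductive_limit_topology (roumieu \<sigma> a b) {E_topology 1 \<tau> \<sigma> a b | \<tau>. \<tau> > 0}"

definition beurling :: "real \<Rightarrow> real \<Rightarrow> real \<Rightarrow> (real \<Rightarrow> 'k::real_normed_field) set" where
  "beurling \<sigma> a b = (\<Inter>\<tau>\<in>{0<..}. E_space 1 \<tau> \<sigma> a b)"

definition beurling_topology :: "real \<Rightarrow> real \<Rightarrow> real \<Rightarrow> (real \<Rightarrow> 'k::real_normed_field) topology" where
  "beurling_topology \<sigma> a b =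
     projective_limit_topology (beurling \<sigma> a b) {E_topology 1 \<tau> \<sigma> a b | \<tau>. \<tau> > 0}"

definition roumieu_h :: "real \<Rightarrow> real \<Rightarrow> real \<Rightarrow> (real \<Rightarrow> 'k::real_normed_field) set" where
  "roumieu_h \<sigma> a b = (\<Union>\<tau>\<in>{0<..}. \<Union>h\<in>{0<..}. E_space h \<tau> \<sigma> a b)"

definition roumieu_h_topology :: "real \<Rightarrow> real \<Rightarrow> real \<Rightarrow> (real \<Rightarrow> 'k::real_normed_field) topology" where
  "roumieu_h_topology \<sigma> a b =
     inductive_limit_topology (roumieu_h \<sigma> a b) {E_topology h \<tau> \<sigma> a b | h \<tau>. h > 0 \<and> \<tau> > 0}"

definition beurling_h :: "real \<Rightarrow> real \<Rightarrow> real \<Rightarrow> (real \<Rightarrow> 'k::real_normed_field) set" where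
  "beurling_h \<sigma> a b = (\<Inter>\<tau>\<in>{0<..}. \<Inter>h\<in>{0<..}. E_space h \<tau> \<sigma> a b)"

definition beurling_h_topology :: "real \<Rightarrow> real \<Rightarrow> real \<Rightarrow> (real \<Rightarrow> 'k::real_normed_field) topology" where
  "beurling_h_topology \<sigma> a b =
     projective_limit_topology (beurling_h \<sigma> a b) {E_topology h \<tau> \<sigma> a b | h \<tau>. h > 0 \<and> \<tau> > 0}"


section \<open>The definitions have the intended universal properties\<close>

lemma nderiv_lincomb:
  fixes f g :: "real \<Rightarrow> 'k::real_normed_field"
  assumes "a < b" "f \<in> smooth_fun a b" "g \<in> smooth_fun a b"
  shows "nderiv a b n (\<lambda>x. c * f x + d * g x) = (\<lambda>x. c * nderiv a b n f x + d * nderiv a b n g x)"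
proof (induction n)
  case (Suc n)
  show ?case
  proof
    fix x
    show "nderiv a b (Suc n) (\<lambda>x. c * f x + d * g x) x
        = c * nderiv a b (Suc n) f x + d * nderiv a b (Suc n) g x"
    proof (cases "x \<in> {a..b}")
      case True
      let ?D = "\<lambda>f. vector_derivative (nderiv a b n f) (at x within {a..b})"
      have "(nderiv a b n f has_vector_derivative ?D f) (at x within {a..b})"
           "(nderiv a b n g has_vector_derivative ?D g) (at x within {a..b})"
        using assms True by (auto simp: smooth_fun_def differentiable_on_def vector_derivative_works)
      then have "((\<lambda>x. c * nderiv a b n f x + d * nderiv a b n g x) has_vector_derivative
          c * ?D f + d * ?D g) (at x within {a..b})"
        by (intro has_vector_derivative_add has_vector_derivative_mult_right)
      then have "?D (\<lambda>x. c * f x + d * g x) = c * ?D f + d * ?D g"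
        unfolding Suc.IH using vector_derivative_within_cbox[of a b x] assms(1) True by simp
      then show ?thesis using True by simp
    next
      case False
      then have "nderiv a b (Suc n) k x = 0" for k :: "real \<Rightarrow> 'k"
        unfolding nderiv.simps by (rule if_not_P)
      then show ?thesis by (simp del: nderiv.simps)
    qed
  qed
qed simp

lemma smooth_fun_lincomb:
  fixes f g :: "real \<Rightarrow> 'k::real_normed_field"
  assumes "a < b" "f \<in> smooth_fun a b" "g \<in> smooth_fun a b"
  shows "(\<lambda>x. c * f x + d * g x) \<in> smooth_fun a b"
proof -
  have "(\<lambda>x. c * nderiv a b n f x + d * nderiv a b n g x) differentiable_on {a..b}" for n
    using assms by (auto simp: smooth_fun_def differentiable_on_def intro!: derivative_intros)
  then show ?thesis
    using assms(2,3) unfolding smooth_fun_def mem_Collect_eq nderiv_lincomb[OF assms] by simp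
qed

lemma bdd_above_nderiv:
  assumes "f \<in> smooth_fun a b"
  shows "bdd_above ((\<lambda>x. norm (nderiv a b n f x)) ` {a..b})"
proof -
  have "continuous_on {a..b} (nderiv a b n f)"
    using assms by (auto simp: smooth_fun_def intro: differentiable_imp_continuous_on)
  then have "compact ((\<lambda>x. norm (nderiv a b n f x)) ` {a..b})"
    by (intro compact_continuous_image continuous_intros) auto
  then show ?thesis
    by (intro bounded_imp_bdd_above compact_imp_bounded)
qed

lemma weight_pos: "h > 0 \<Longrightarrow> h powr (real n powr \<sigma>) * M_seq \<tau> \<sigma> n > 0"
  by (auto simp: M_seq_def)

lemma deriv_quot_nonneg:
  assumes "a < b" "h > 0" "f \<in> smooth_fun a b"
  shows "0 \<le> deriv_quot h \<tau> \<sigma> a b f n"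
proof -
  have "0 \<le> norm (nderiv a b n f a)" by simp
  also have "\<dots> \<le> (SUP x\<in>{a..b}. norm (nderiv a b n f x))"
    using assms by (intro cSUP_upper bdd_above_nderiv) auto
  finally show ?thesis
    using weight_pos[OF assms(2), of n \<sigma> \<tau>] by (simp add: deriv_quot_def)
qed

lemma deriv_quot_lincomb:
  fixes f g :: "real \<Rightarrow> 'k::real_normed_field"
  assumes "a < b" "h > 0" "f \<in> smooth_fun a b" "g \<in> smooth_fun a b"
  shows "deriv_quot h \<tau> \<sigma> a b (\<lambda>x. c * f x + d * g x) n
    \<le> norm c * deriv_quot h \<tau> \<sigma> a b f n + norm d * deriv_quot h \<tau> \<sigma> a b g n"
proof -
  let ?w = "h powr (real n powr \<sigma>) * M_seq \<tau> \<sigma> n"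
  let ?S = "\<lambda>f :: real \<Rightarrow> 'k. SUP x\<in>{a..b}. norm (nderiv a b n f x)"
  have "?S (\<lambda>x. c * f x + d * g x) \<le> norm c * ?S f + norm d * ?S g"
  proof (rule cSUP_least)
    fix x assume x: "x \<in> {a..b}"
    have "norm (nderiv a b n (\<lambda>x. c * f x + d * g x) x)
        \<le> norm c * norm (nderiv a b n f x) + norm d * norm (nderiv a b n g x)"
      unfolding nderiv_lincomb[OF assms(1,3,4)] by (rule norm_triangle_le) (simp add: norm_mult)
    also have "\<dots> \<le> norm c * ?S f + norm d * ?S g"
      using x assms by (intro add_mono mult_left_mono cSUP_upper bdd_above_nderiv) auto
    finally show "norm (nderiv a b n (\<lambda>x. c * f x + d * g x) x) \<le> norm c * ?S f + norm d * ?S g" .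
  qed (use assms in auto)
  then have "?S (\<lambda>x. c * f x + d * g x) / ?w \<le> (norm c * ?S f + norm d * ?S g) / ?w"
    using less_imp_le[OF weight_pos[OF assms(2)]] by (rule divide_right_mono)
  then show ?thesis by (simp add: deriv_quot_def add_divide_distrib)
qed

lemma deriv_quot_le_E_norm:
  "f \<in> E_space h \<tau> \<sigma> a b \<Longrightarrow> deriv_quot h \<tau> \<sigma> a b f n \<le> E_norm h \<tau> \<sigma> a b f"
  by (auto simp: E_norm_def E_space_def intro!: cSUP_upper)

lemma E_norm_least:
  "f \<in> E_space h \<tau> \<sigma> a b \<Longrightarrow> (\<And>n. deriv_quot h \<tau> \<sigma> a b f n \<le> C) \<Longrightarrow> E_norm h \<tau> \<sigma> a b f \<le> C"
  by (auto simp: E_norm_def intro!: cSUP_least)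

lemma E_lincomb:
  fixes f g :: "real \<Rightarrow> 'k::real_normed_field"
  assumes "a < b" "h > 0" and f: "f \<in> E_space h \<tau> \<sigma> a b" and g: "g \<in> E_space h \<tau> \<sigma> a b"
  shows "(\<lambda>x. c * f x + d * g x) \<in> E_space h \<tau> \<sigma> a b"
    and "E_norm h \<tau> \<sigma> a b (\<lambda>x. c * f x + d * g x)
          \<le> norm c * E_norm h \<tau> \<sigma> a b f + norm d * E_norm h \<tau> \<sigma> a b g"
proof -
  have sm: "f \<in> smooth_fun a b" "g \<in> smooth_fun a b"
    using f g by (auto simp: E_space_def)
  have bd: "deriv_quot h \<tau> \<sigma> a b (\<lambda>x. c * f x + d * g x) n
      \<le> norm c * E_norm h \<tau> \<sigma> a b f + norm d * E_norm h \<tau> \<sigma> a b g" for n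
    by (rule order_trans[OF deriv_quot_lincomb[OF assms(1,2) sm]])
       (intro add_mono mult_left_mono deriv_quot_le_E_norm f g norm_ge_zero)
  show *: "(\<lambda>x. c * f x + d * g x) \<in> E_space h \<tau> \<sigma> a b"
    unfolding E_space_def using smooth_fun_lincomb[OF assms(1) sm] bd
    by (auto intro!: bdd_aboveI)
  show "E_norm h \<tau> \<sigma> a b (\<lambda>x. c * f x + d * g x)
      \<le> norm c * E_norm h \<tau> \<sigma> a b f + norm d * E_norm h \<tau> \<sigma> a b g"
    by (rule E_norm_least[OF * bd])
qed

lemma E_norm_nonneg:
  assumes "a < b" "h > 0"
  shows "0 \<le> E_norm h \<tau> \<sigma> a b f"
proof (cases "f \<in> E_space h \<tau> \<sigma> a b")
  case True
  then have "f \<in> smooth_fun a b" by (simp add: E_space_def)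
  from deriv_quot_nonneg[OF assms this] deriv_quot_le_E_norm[OF True] show ?thesis
    by (rule order_trans)
qed (simp add: E_norm_def)

lemma zero_in_E_space:
  assumes "a < b" "h > 0"
  shows "(\<lambda>x. 0) \<in> (E_space h \<tau> \<sigma> a b :: (real \<Rightarrow> 'k::real_normed_field) set)"
proof -
  have n0: "nderiv a b n (\<lambda>x. 0 :: 'k) = (\<lambda>x. 0)" for n
    using assms
    by (induction n) (auto intro!: ext vector_derivative_within_cbox[of a b, simplified])
  have "deriv_quot h \<tau> \<sigma> a b (\<lambda>x. 0 :: 'k) = (\<lambda>n. 0)"
    using assms by (auto simp: deriv_quot_def n0)
  then show ?thesis by (simp add: E_space_def smooth_fun_def n0)
qed

lemma E_norm_zero_iff:
  assumes "a < b" "h > 0" "f \<in> E_space h \<tau> \<sigma> a b"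
  shows "E_norm h \<tau> \<sigma> a b f = 0 \<longleftrightarrow> f = (\<lambda>x. 0)"
proof
  assume 0: "E_norm h \<tau> \<sigma> a b f = 0"
  have sm: "f \<in> smooth_fun a b" using assms(3) by (simp add: E_space_def)
  have *: "(SUP x\<in>{a..b}. norm (f x)) \<le> 0"
    using deriv_quot_le_E_norm[OF assms(3), of 0] assms(2) 0 by (simp add: deriv_quot_def M_seq_def)
  show "f = (\<lambda>x. 0)"
  proof
    fix x
    show "f x = 0"
    proof (cases "x \<in> {a..b}")
      case True
      then have "norm (f x) \<le> (SUP x\<in>{a..b}. norm (f x))"
        using bdd_above_nderiv[OF sm, of 0] by (intro cSUP_upper) auto
      with * show ?thesis by (meson norm_le_zero_iff order_trans)
    qed (use sm in \<open>auto simp: smooth_fun_def\<close>)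
  qed
next
  assume "f = (\<lambda>x. 0)"
  then show "E_norm h \<tau> \<sigma> a b f = 0"
    using E_lincomb(2)[OF assms(1,2,3,3), of 0 0] E_norm_nonneg[OF assms(1,2), of \<tau> \<sigma> f] by simp
qed

lemma E_Metric_space:
  assumes "a < b" "h > 0"
  shows "Metric_space (E_space h \<tau> \<sigma> a b :: (real \<Rightarrow> 'k::real_normed_field) set)
           (\<lambda>f g. E_norm h \<tau> \<sigma> a b (\<lambda>x. f x - g x))"
proof
  let ?N = "E_norm h \<tau> \<sigma> a b :: (real \<Rightarrow> 'k) \<Rightarrow> real"
  let ?E = "E_space h \<tau> \<sigma> a b :: (real \<Rightarrow> 'k) set"
  have diff: "(\<lambda>x. f x - g x) \<in> ?E" if "f \<in> ?E" "g \<in> ?E" for f g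
    using E_lincomb(1)[OF assms that, of 1 "-1"] by simp
  have neg: "(\<lambda>x. g x - f x) \<in> ?E \<and> ?N (\<lambda>x. g x - f x) \<le> ?N (\<lambda>x. f x - g x)"
    if "(\<lambda>x. f x - g x) \<in> ?E" for f g
    using E_lincomb[OF assms that that, of "-1" 0] by simp
  show "0 \<le> ?N (\<lambda>x. f x - g x)" for f g :: "real \<Rightarrow> 'k"
    by (rule E_norm_nonneg[OF assms])
  show "?N (\<lambda>x. f x - g x) = ?N (\<lambda>x. g x - f x)" for f g :: "real \<Rightarrow> 'k"
  proof (cases "(\<lambda>x. f x - g x) \<in> ?E")
    case True
    then show ?thesis using neg[of f g] neg[of g f] by auto
  next
    case False
    then show ?thesis using neg[of g f] by (auto simp: E_norm_def)
  qed
  show "?N (\<lambda>x. f x - g x) = 0 \<longleftrightarrow> f = g" if "f \<in> ?E" "g \<in> ?E" for f g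
    using E_norm_zero_iff[OF assms diff[OF that]] by (auto simp: fun_eq_iff)
  show "?N (\<lambda>x. f x - k x) \<le> ?N (\<lambda>x. f x - g x) + ?N (\<lambda>x. g x - k x)"
    if "f \<in> ?E" "g \<in> ?E" "k \<in> ?E" for f g k
    using E_lincomb(2)[OF assms diff[OF that(1,2)] diff[OF that(2,3)], of 1 1] by simp
qed

lemma openin_inductive_limit:
  "inductive_limit_candidate V \<S> T \<Longrightarrow> openin T U \<Longrightarrow> openin (inductive_limit_topology V \<S>) U"
  unfolding inductive_limit_topology_def by (rule topology_generated_by_Basis) blast

lemma convex_fun_set_Int:
  "convex_fun_set A \<Longrightarrow> convex_fun_set B \<Longrightarrow> convex_fun_set (A \<inter> B)"
  by (auto simp: convex_fun_set_def)

lemma prod_topology_refine: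
  assumes "\<And>U. openin X U \<Longrightarrow> openin X' U" "\<And>U. openin Y U \<Longrightarrow> openin Y' U"
    and "openin (prod_topology X Y) W"
  shows "openin (prod_topology X' Y') W"
  using assms unfolding openin_prod_topology_alt by metis

lemma inductive_limit_topology_finest:
  fixes V :: "('a \<Rightarrow> 'k::real_normed_field) set"
  assumes V0: "(\<lambda>x. 0) \<in> V"
    and Vadd: "\<And>f g. f \<in> V \<Longrightarrow> g \<in> V \<Longrightarrow> (\<lambda>x. f x + g x) \<in> V"
    and Vscale: "\<And>c f. f \<in> V \<Longrightarrow> (\<lambda>x. c * f x) \<in> V"
    and sub: "\<And>S. S \<in> \<S> \<Longrightarrow> topspace S \<subseteq> V"
  shows "inductive_limit_candidate V \<S> (inductive_limit_topology V \<S>)"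
    and "\<And>T U. inductive_limit_candidate V \<S> T \<Longrightarrow> openin T U \<Longrightarrow>
           openin (inductive_limit_topology V \<S>) U"
proof -
  let ?B = "{U. \<exists>T. inductive_limit_candidate V \<S> T \<and> openin T U}"
  let ?I = "inductive_limit_topology V \<S>"
  let ?triv = "topology (\<lambda>U. U = {} \<or> U = V)"
  have ist: "istopology (\<lambda>U. U = {} \<or> U = V)"
    unfolding istopology_def by blast
  have op: "openin ?triv U \<longleftrightarrow> U = {} \<or> U = V" for U
    using topology_inverse'[OF ist] by simp
  have ts: "topspace ?triv = V"
    unfolding topspace_def by (auto simp: op)
  have cmap: "continuous_map X ?triv f" if "f \<in> topspace X \<rightarrow> V"
    for X :: "('a \<Rightarrow> 'k) topology" and f
    unfolding continuous_map_def ts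
  proof (intro conjI allI impI)
    show "f \<in> topspace X \<rightarrow> V" by fact
    fix U assume "openin ?triv U"
    then consider "U = {}" | "U = V" using op by blast
    then show "openin X {x \<in> topspace X. f x \<in> U}"
    proof cases
      case 2
      then have "{x \<in> topspace X. f x \<in> U} = topspace X" using that by auto
      then show ?thesis by simp
    qed simp
  qed
  have convV: "convex_fun_set V"
    unfolding convex_fun_set_def
  proof (intro ballI)
    fix f g and t :: real assume "f \<in> V" "g \<in> V"
    then have "(\<lambda>x. of_real (1 - t) * f x + of_real t * g x) \<in> V"
      by (intro Vadd Vscale)
    then show "(\<lambda>x. (1 - t) *\<^sub>R f x + t *\<^sub>R g x) \<in> V"
      by (simp add: scaleR_conv_of_real)
  qed
  have triv: "inductive_limit_candidate V \<S> ?triv"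
    unfolding inductive_limit_candidate_def locally_convex_topology_def ts
  proof (intro conjI)
    show "continuous_map (prod_topology ?triv ?triv) ?triv (\<lambda>(f, g). (\<lambda>x. f x + g x))"
      unfolding continuous_map_def ts
    proof (intro conjI allI impI)
      show "(\<lambda>(f, g). (\<lambda>x. f x + g x)) \<in> topspace (prod_topology ?triv ?triv) \<rightarrow> V"
        using Vadd by (auto simp: ts)
      fix U assume "openin ?triv U"
      then have "U = {} \<or> {x \<in> topspace (prod_topology ?triv ?triv). (case x of (f, g) \<Rightarrow> \<lambda>x. f x + g x) \<in> U}
          = topspace (prod_topology ?triv ?triv)"
        using Vadd by (auto simp: ts op)
      then show "openin (prod_topology ?triv ?triv)
          {x \<in> topspace (prod_topology ?triv ?triv). (case x of (f, g) \<Rightarrow> \<lambda>x. f x + g x) \<in> U}"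
        by (elim disjE) (simp_all only: openin_topspace empty_iff simp_thms Collect_empty_eq openin_empty empty_def[symmetric])
    qed
    show "continuous_map (prod_topology euclidean ?triv) ?triv (\<lambda>(c, f). (\<lambda>x. c * f x))"
      unfolding continuous_map_def ts
    proof (intro conjI allI impI)
      show "(\<lambda>(c, f). (\<lambda>x. c * f x)) \<in> topspace (prod_topology euclidean ?triv) \<rightarrow> V"
        using Vscale by (auto simp: ts)
      fix U assume "openin ?triv U"
      then have "U = {} \<or> {x \<in> topspace (prod_topology euclidean ?triv). (case x of (c, f) \<Rightarrow> \<lambda>x. c * f x) \<in> U}
          = topspace (prod_topology euclidean ?triv)"
        using Vscale by (auto simp: ts op)
      then show "openin (prod_topology euclidean ?triv)
          {x \<in> topspace (prod_topology euclidean ?triv). (case x of (c, f) \<Rightarrow> \<lambda>x. c * f x) \<in> U}"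
        by (elim disjE) (simp_all only: openin_topspace empty_iff simp_thms Collect_empty_eq openin_empty empty_def[symmetric])
    qed
    show "\<forall>U. openin ?triv U \<and> (\<lambda>x. 0) \<in> U \<longrightarrow>
        (\<exists>C. openin ?triv C \<and> (\<lambda>x. 0) \<in> C \<and> C \<subseteq> U \<and> convex_fun_set C)"
      using convV by (auto simp: op)
    show "\<forall>S\<in>\<S>. continuous_map S ?triv (\<lambda>f. f)"
      using sub by (auto intro!: cmap)
  qed (use V0 in auto)
  have finer: "openin ?I U" if "inductive_limit_candidate V \<S> T" "openin T U" for T U
    using openin_inductive_limit that .
  have "\<Union>?B = V"
  proof
    show "\<Union>?B \<subseteq> V"
      using openin_subset by (fastforce simp: inductive_limit_candidate_def)
    show "V \<subseteq> \<Union>?B"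
      using triv op by blast
  qed
  then have tsI: "topspace ?I = V"
    by (simp add: inductive_limit_topology_def)
  have lcT: "locally_convex_topology T" "topspace T = V"
      "\<And>S. S \<in> \<S> \<Longrightarrow> continuous_map S T (\<lambda>f. f)"
    if "inductive_limit_candidate V \<S> T" for T
    using that by (auto simp: inductive_limit_candidate_def)
  have add: "continuous_map (prod_topology ?I ?I) ?I (\<lambda>(f, g). (\<lambda>x. f x + g x))"
    unfolding inductive_limit_topology_def[of V \<S>]
  proof (rule continuous_on_generated_topo, fold inductive_limit_topology_def)
    show "openin (prod_topology ?I ?I) ((\<lambda>(f, g). (\<lambda>x. f x + g x)) -` U \<inter> topspace (prod_topology ?I ?I))"
      if U: "U \<in> ?B" for U
    proof -
      obtain T where T: "inductive_limit_candidate V \<S> T" "openin T U" using U by blast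
      have "openin (prod_topology T T) ((\<lambda>(f, g). (\<lambda>x. f x + g x)) -` U \<inter> topspace (prod_topology T T))"
        using lcT(1)[OF T(1)] T(2) unfolding locally_convex_topology_def continuous_map_alt by blast
      then have "openin (prod_topology ?I ?I) ((\<lambda>(f, g). (\<lambda>x. f x + g x)) -` U \<inter> topspace (prod_topology T T))"
        by (rule prod_topology_refine[rotated -1]) (use finer[OF T(1)] in auto)
      then show ?thesis
        by (simp add: tsI lcT(2)[OF T(1)])
    qed
    show "(\<lambda>(f, g). (\<lambda>x. f x + g x)) ` topspace (prod_topology ?I ?I) \<subseteq> \<Union>?B"
      unfolding \<open>\<Union>?B = V\<close> using Vadd tsI by auto
  qed
  have scale: "continuous_map (prod_topology euclidean ?I) ?I (\<lambda>(c, f). (\<lambda>x. c * f x))"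
    unfolding inductive_limit_topology_def[of V \<S>]
  proof (rule continuous_on_generated_topo, fold inductive_limit_topology_def)
    show "openin (prod_topology euclidean ?I) ((\<lambda>(c, f). (\<lambda>x. c * f x)) -` U \<inter> topspace (prod_topology euclidean ?I))"
      if U: "U \<in> ?B" for U
    proof -
      obtain T where T: "inductive_limit_candidate V \<S> T" "openin T U" using U by blast
      have "openin (prod_topology euclidean T) ((\<lambda>(c, f). (\<lambda>x. c * f x)) -` U \<inter> topspace (prod_topology euclidean T))"
        using lcT(1)[OF T(1)] T(2) unfolding locally_convex_topology_def continuous_map_alt by blast
      then have "openin (prod_topology euclidean ?I) ((\<lambda>(c, f). (\<lambda>x. c * f x)) -` U \<inter> topspace (prod_topology euclidean T))"
        by (rule prod_topology_refine[rotated -1]) (use finer[OF T(1)] in auto)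
      then show ?thesis
        by (simp add: tsI lcT(2)[OF T(1)])
    qed
    show "(\<lambda>(c, f). (\<lambda>x. c * f x)) ` topspace (prod_topology euclidean ?I) \<subseteq> \<Union>?B"
      unfolding \<open>\<Union>?B = V\<close> using Vscale tsI by auto
  qed
  have base: "\<exists>C. openin ?I C \<and> (\<lambda>x. 0) \<in> C \<and> C \<subseteq> U \<and> convex_fun_set C"
    if "openin ?I U" "(\<lambda>x. 0) \<in> U" for U
  proof -
    have "generate_topology_on ?B U"
      using that(1) unfolding inductive_limit_topology_def openin_topology_generated_by_iff .
    then show ?thesis using that(2)
    proof (induction rule: generate_topology_on.induct)
      case (Int A B)
      then obtain C D where "openin ?I C" "(\<lambda>x. 0) \<in> C" "C \<subseteq> A" "convex_fun_set C"
        "openin ?I D" "(\<lambda>x. 0) \<in> D" "D \<subseteq> B" "convex_fun_set D"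
        by auto
      then show ?case
        by (intro exI[of _ "C \<inter> D"]) (auto intro: convex_fun_set_Int)
    next
      case (UN K)
      then obtain k where k: "k \<in> K" "(\<lambda>x. 0) \<in> k" by blast
      from UN.IH[OF k] obtain C where "openin ?I C" "(\<lambda>x. 0) \<in> C" "C \<subseteq> k" "convex_fun_set C"
        by blast
      with k(1) show ?case by (intro exI[of _ C]) auto
    next
      case (Basis W)
      then obtain T where T: "inductive_limit_candidate V \<S> T" "openin T W" by blast
      then obtain C where "openin T C" "(\<lambda>x. 0) \<in> C" "C \<subseteq> W" "convex_fun_set C"
        using lcT(1)[OF T(1)] Basis(2) unfolding locally_convex_topology_def by meson
      then show ?case using finer[OF T(1)] by meson
    next
      case Empty
      then show ?case by simp
    qed
  qed
  have incl: "continuous_map S ?I (\<lambda>f. f)" if "S \<in> \<S>" for S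
    unfolding inductive_limit_topology_def
  proof (rule continuous_on_generated_topo)
    show "openin S ((\<lambda>f. f) -` U \<inter> topspace S)" if U: "U \<in> ?B" for U
    proof -
      obtain T where T: "inductive_limit_candidate V \<S> T" "openin T U" using U by blast
      show ?thesis
        using lcT(3)[OF T(1) \<open>S \<in> \<S>\<close>] T(2) unfolding continuous_map_alt by blast
    qed
    show "(\<lambda>f. f) ` topspace S \<subseteq> \<Union>?B"
      unfolding \<open>\<Union>?B = V\<close> using sub[OF that] by auto
  qed
  show "inductive_limit_candidate V \<S> ?I"
    unfolding inductive_limit_candidate_def locally_convex_topology_def
    by (intro conjI allI impI ballI)
       (use tsI V0 add scale base incl in \<open>simp_all only:\<close>)
  show "\<And>T U. inductive_limit_candidate V \<S> T \<Longrightarrow> openin T U \<Longrightarrow> openin ?I U"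
    by (rule finer)
qed

lemma projective_limit_topology_coarsest:
  assumes "\<S> \<noteq> {}" and sub: "\<And>S. S \<in> \<S> \<Longrightarrow> V \<subseteq> topspace S"
  shows "topspace (projective_limit_topology V \<S>) = V"
    and "\<And>S. S \<in> \<S> \<Longrightarrow> continuous_map (projective_limit_topology V \<S>) S (\<lambda>f. f)"
    and "\<And>T U. topspace T = V \<Longrightarrow> (\<And>S. S \<in> \<S> \<Longrightarrow> continuous_map T S (\<lambda>f. f)) \<Longrightarrow>
           openin (projective_limit_topology V \<S>) U \<Longrightarrow> openin T U"
proof -
  let ?B = "{V \<inter> U | U. \<exists>S\<in>\<S>. openin S U}"
  have ts: "\<Union>?B = V"
  proof
    obtain S where "S \<in> \<S>" using assms(1) by blast
    then have "V = V \<inter> topspace S" using sub by blast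
    then have "V \<in> ?B" using \<open>S \<in> \<S>\<close> by blast
    then show "V \<subseteq> \<Union>?B" by blast
  qed auto
  then show tsP: "topspace (projective_limit_topology V \<S>) = V"
    by (simp add: projective_limit_topology_def)
  show "continuous_map (projective_limit_topology V \<S>) S (\<lambda>f. f)" if "S \<in> \<S>" for S
    unfolding continuous_map_alt tsP
  proof (intro conjI allI impI)
    fix U assume "openin S U"
    then have "V \<inter> U \<in> ?B" using that by blast
    then have "openin (projective_limit_topology V \<S>) (V \<inter> U)"
      unfolding projective_limit_topology_def by (rule topology_generated_by_Basis)
    then show "openin (projective_limit_topology V \<S>) ((\<lambda>f. f) -` U \<inter> V)"
      by (simp add: vimage_def Int_commute)
  qed (use sub[OF that] in auto)
  show "openin T U"
    if T: "topspace T = V" "\<And>S. S \<in> \<S> \<Longrightarrow> continuous_map T S (\<lambda>f. f)"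
      and U: "openin (projective_limit_topology V \<S>) U" for T U
  proof -
    have "generate_topology_on ?B U"
      using U unfolding projective_limit_topology_def openin_topology_generated_by_iff .
    then show ?thesis
    proof (induction rule: generate_topology_on.induct)
      case (Basis W)
      then obtain S U where S: "S \<in> \<S>" "openin S U" and W: "W = V \<inter> U" by blast
      have "openin T ((\<lambda>f. f) -` U \<inter> topspace T)"
        using T(2)[OF S(1)] S(2) unfolding continuous_map_alt by blast
      then show ?case by (simp add: W T(1) vimage_def Int_commute)
    qed auto
  qed
qed

lemma topspace_E_topology:
  "a < b \<Longrightarrow> h > 0 \<Longrightarrow> topspace (E_topology h \<tau> \<sigma> a b) = E_space h \<tau> \<sigma> a b"
  unfolding E_topology_def by (rule Metric_space.topspace_mtopology[OF E_Metric_space])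

lemma E_space_mono:
  assumes "a < b" "0 < h" "h \<le> h'" "\<tau> \<le> \<tau>'"
  shows "E_space h \<tau> \<sigma> a b \<subseteq> E_space h' \<tau>' \<sigma> a b"
proof
  fix f :: "real \<Rightarrow> 'k::real_normed_field" assume f: "f \<in> E_space h \<tau> \<sigma> a b"
  then have sm: "f \<in> smooth_fun a b" by (simp add: E_space_def)
  have "deriv_quot h' \<tau>' \<sigma> a b f n \<le> deriv_quot h \<tau> \<sigma> a b f n" for n
  proof -
    let ?S = "SUP x\<in>{a..b}. norm (nderiv a b n f x)"
    have "0 \<le> norm (nderiv a b n f a)" by simp
    also have "\<dots> \<le> ?S"
      using assms by (intro cSUP_upper bdd_above_nderiv[OF sm]) auto
    finally have "0 \<le> ?S" .
    moreover have "M_seq \<tau> \<sigma> n \<le> M_seq \<tau>' \<sigma> n"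
      using assms by (auto simp: M_seq_def intro!: powr_mono mult_right_mono)
    then have "h powr (real n powr \<sigma>) * M_seq \<tau> \<sigma> n \<le> h' powr (real n powr \<sigma>) * M_seq \<tau>' \<sigma> n"
      using assms by (intro mult_mono powr_mono2) (auto simp: M_seq_def)
    moreover have "0 < h powr (real n powr \<sigma>) * M_seq \<tau> \<sigma> n"
      by (rule weight_pos) fact
    ultimately show ?thesis
      unfolding deriv_quot_def by (intro divide_left_mono) auto
  qed
  then have "deriv_quot h' \<tau>' \<sigma> a b f n \<le> E_norm h \<tau> \<sigma> a b f" for n
    using deriv_quot_le_E_norm[OF f] order_trans by blast
  then show "f \<in> E_space h' \<tau>' \<sigma> a b"
    using sm by (auto simp: E_space_def intro!: bdd_aboveI)
qed

lemma roumieu_topology_candidate: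
  assumes "a < b"
  shows "inductive_limit_candidate (roumieu \<sigma> a b :: (real \<Rightarrow> 'k::real_normed_field) set)
           {E_topology 1 \<tau> \<sigma> a b | \<tau>. \<tau> > 0} (roumieu_topology \<sigma> a b)"
  unfolding roumieu_topology_def
proof (rule inductive_limit_topology_finest(1))
  let ?V = "roumieu \<sigma> a b :: (real \<Rightarrow> 'k) set"
  show "(\<lambda>x. 0) \<in> ?V"
    unfolding roumieu_def using zero_in_E_space[OF assms, of 1] by (auto intro!: bexI[of _ 1])
  show "(\<lambda>x. f x + g x) \<in> ?V" if fg: "f \<in> ?V" "g \<in> ?V" for f g
  proof -
    obtain s t where "s > 0" "f \<in> E_space 1 s \<sigma> a b" "t > 0" "g \<in> E_space 1 t \<sigma> a b"
      using fg by (auto simp: roumieu_def)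
    then have "f \<in> E_space 1 (max s t) \<sigma> a b" "g \<in> E_space 1 (max s t) \<sigma> a b"
      using E_space_mono[OF assms, of 1 1 s "max s t" \<sigma>]
        E_space_mono[OF assms, of 1 1 t "max s t" \<sigma>] by auto
    from E_lincomb(1)[OF assms _ this, of 1 1] \<open>s > 0\<close> show ?thesis
      by (auto simp: roumieu_def intro!: bexI[of _ "max s t"])
  qed
  show "(\<lambda>x. c * f x) \<in> ?V" if f: "f \<in> ?V" for c f
  proof -
    obtain t where t: "t > 0" "f \<in> E_space 1 t \<sigma> a b"
      using f by (auto simp: roumieu_def)
    from E_lincomb(1)[OF assms _ t(2) t(2), of c 0] t(1) show ?thesis
      by (auto simp: roumieu_def)
  qed
  show "topspace S \<subseteq> ?V" if "S \<in> {E_topology 1 \<tau> \<sigma> a b | \<tau>. \<tau> > 0}" for S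
    using that topspace_E_topology[OF assms, of 1] by (auto simp: roumieu_def)
qed

lemma roumieu_h_topology_candidate:
  assumes "a < b"
  shows "inductive_limit_candidate (roumieu_h \<sigma> a b :: (real \<Rightarrow> 'k::real_normed_field) set)
           {E_topology h \<tau> \<sigma> a b | h \<tau>. h > 0 \<and> \<tau> > 0} (roumieu_h_topology \<sigma> a b)"
  unfolding roumieu_h_topology_def
proof (rule inductive_limit_topology_finest(1))
  let ?V = "roumieu_h \<sigma> a b :: (real \<Rightarrow> 'k) set"
  have memI: "f \<in> ?V" if "f \<in> E_space h t \<sigma> a b" "h > 0" "t > 0" for f h t
    using that by (auto simp: roumieu_h_def)
  show "(\<lambda>x. 0) \<in> ?V"
    by (rule memI[of _ 1 1]) (use zero_in_E_space[OF assms, of 1] in auto)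
  show "(\<lambda>x. f x + g x) \<in> ?V" if fg: "f \<in> ?V" "g \<in> ?V" for f g
  proof -
    obtain s t h k where *: "s > 0" "h > 0" "f \<in> E_space h s \<sigma> a b"
        "t > 0" "k > 0" "g \<in> E_space k t \<sigma> a b"
      using fg by (auto simp: roumieu_h_def)
    then have "f \<in> E_space (max h k) (max s t) \<sigma> a b" "g \<in> E_space (max h k) (max s t) \<sigma> a b"
      using E_space_mono[OF assms, of h "max h k" s "max s t" \<sigma>]
        E_space_mono[OF assms, of k "max h k" t "max s t" \<sigma>] by auto
    from E_lincomb(1)[OF assms _ this, of 1 1] * show ?thesis
      by (intro memI[of _ "max h k" "max s t"]) auto
  qed
  show "(\<lambda>x. c * f x) \<in> ?V" if f: "f \<in> ?V" for c f
  proof -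
    obtain t h where t: "t > 0" "h > 0" "f \<in> E_space h t \<sigma> a b"
      using f by (auto simp: roumieu_h_def)
    from E_lincomb(1)[OF assms t(2,3,3), of c 0] t show ?thesis
      by (intro memI[of _ h t]) auto
  qed
  show "topspace S \<subseteq> ?V" if "S \<in> {E_topology h \<tau> \<sigma> a b | h \<tau>. h > 0 \<and> \<tau> > 0}" for S
    using that by (auto simp: topspace_E_topology[OF assms] intro: memI)
qed

end

theory Submission
  imports Defs
begin

text \<open>
  Since \<open>h^(n^\<sigma>) n^(\<tau> n^\<sigma>) = exp (n^\<sigma> (ln h + \<tau> ln n))\<close>, increasing \<open>\<tau>\<close> by any positive amount
  absorbs every geometric factor \<open>h^(n^\<sigma>)\<close>.  Hence for \<open>\<tau> < \<tau>'\<close> the space with parameters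
  \<open>(h, \<tau>)\<close> embeds continuously into the one with parameters \<open>(h', \<tau>')\<close>, whatever \<open>h\<close> and
  \<open>h'\<close> are, so the two families of Banach spaces are cofinal in one another and have the
  same limits.
\<close>

section \<open>Comparison of the weights and the resulting embeddings of the Banach spaces\<close>

lemma weight_eventually_le:
  assumes "0 < h" "0 < h'" "\<tau> < \<tau>'"
  shows "eventually (\<lambda>n. h powr (real n powr \<sigma>) * M_seq \<tau> \<sigma> n
           \<le> h' powr (real n powr \<sigma>) * M_seq \<tau>' \<sigma> n) sequentially"
proof -
  have "filterlim (\<lambda>n. ln (real n)) at_top sequentially"
    by (rule filterlim_compose[OF ln_at_top filterlim_real_sequentially])
  \<comment> \<open>This threshold is the value of \<open>ln (real n)\<close> at which
    \<open>ln h + \<tau> * ln (real n)\<close> and \<open>ln h' + \<tau>' * ln (real n)\<close>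
    agree. Beyond it the larger slope \<open>\<tau>'\<close> wins.\<close>
  then have "eventually (\<lambda>n. (ln h - ln h') / (\<tau>' - \<tau>) \<le> ln (real n)) sequentially"
    by (simp add: filterlim_at_top)
  then show ?thesis
    using eventually_gt_at_top[of 0]
  proof eventually_elim
    case (elim n)
    have *: "k powr (real n powr \<sigma>) * M_seq t \<sigma> n = exp (real n powr \<sigma> * (ln k + t * ln (real n)))"
      if "0 < k" for k t
      using that elim(2) by (simp add: M_seq_def powr_def exp_add algebra_simps)
    have "ln h - ln h' \<le> ln (real n) * (\<tau>' - \<tau>)"
      using elim(1) assms(3) by (simp add: pos_divide_le_eq)
    then have "real n powr \<sigma> * (ln h + \<tau> * ln (real n))
        \<le> real n powr \<sigma> * (ln h' + \<tau>' * ln (real n))"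
      by (intro mult_left_mono) (auto simp: algebra_simps)
    then show ?case
      by (simp add: *[OF assms(1)] *[OF assms(2)])
  qed
qed

text \<open>The quotient of the two weights is positive and eventually at most 1, and an eventually
  bounded sequence is bounded. The constant \<open>A\<close> thus also covers the finitely many
  small \<open>n\<close>, where the weights may compare the other way.\<close>

lemma weight_bound:
  assumes "0 < h" "0 < h'" "\<tau> < \<tau>'"
  obtains A where "0 < A"
    and "\<And>n. h powr (real n powr \<sigma>) * M_seq \<tau> \<sigma> n \<le> A * (h' powr (real n powr \<sigma>) * M_seq \<tau>' \<sigma> n)"
proof -
  let ?v = "\<lambda>n. h powr (real n powr \<sigma>) * M_seq \<tau> \<sigma> n"
  let ?w = "\<lambda>n. h' powr (real n powr \<sigma>) * M_seq \<tau>' \<sigma> n"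
  have v: "0 < ?v n" and w: "0 < ?w n" for n
    by (rule weight_pos[OF assms(1)], rule weight_pos[OF assms(2)])
  have "eventually (\<lambda>n. norm (?v n / ?w n) \<le> 1) sequentially"
    using weight_eventually_le[OF assms, of \<sigma>]
  proof eventually_elim
    case (elim n)
    have "norm (?v n / ?w n) = ?v n / ?w n"
      using v w by (simp only: real_norm_def abs_of_pos divide_pos_pos)
    with elim w show ?case by (simp only: pos_divide_le_eq mult_1)
  qed
  then have "Bseq (\<lambda>n. ?v n / ?w n)"
    by (rule BfunI)
  then obtain A where "0 < A" and A: "\<And>n. norm (?v n / ?w n) \<le> A"
    by (auto elim: BseqE)
  have "?v n \<le> A * ?w n" for n
  proof -
    have "?v n / ?w n \<le> A"
      using A[of n] by (rule order_trans[rotated]) (simp only: real_norm_def abs_ge_self)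
    with w show ?thesis by (simp only: pos_divide_le_eq)
  qed
  with \<open>0 < A\<close> show thesis by (rule that)
qed

text \<open>Both norms weigh the same suprema of derivatives, so a comparison of the weights is all
  that is needed. \<open>A\<close> comes from the weights alone and is therefore uniform in
  \<open>f\<close>, which is what makes the inclusion a bounded map.\<close>

lemma E_embedding:
  assumes "a < b" "0 < h" "0 < h'" "\<tau> < \<tau>'"
  obtains A where "0 < A"
    and "\<And>f :: real \<Rightarrow> 'k::real_normed_field. f \<in> E_space h \<tau> \<sigma> a b \<Longrightarrow>
           f \<in> E_space h' \<tau>' \<sigma> a b \<and> E_norm h' \<tau>' \<sigma> a b f \<le> A * E_norm h \<tau> \<sigma> a b f"
proof -
  obtain A where "0 < A" and
    A: "\<And>n. h powr (real n powr \<sigma>) * M_seq \<tau> \<sigma> n \<le> A * (h' powr (real n powr \<sigma>) * M_seq \<tau>' \<sigma> n)"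
    using weight_bound[OF assms(2-4)] by blast
  have "f \<in> E_space h' \<tau>' \<sigma> a b \<and> E_norm h' \<tau>' \<sigma> a b f \<le> A * E_norm h \<tau> \<sigma> a b f"
    if f: "f \<in> E_space h \<tau> \<sigma> a b" for f :: "real \<Rightarrow> 'k"
  proof -
    have sm: "f \<in> smooth_fun a b" using f by (simp add: E_space_def)
    have bound: "deriv_quot h' \<tau>' \<sigma> a b f n \<le> A * E_norm h \<tau> \<sigma> a b f" for n
    proof -
      let ?v = "h powr (real n powr \<sigma>) * M_seq \<tau> \<sigma> n"
      let ?w = "h' powr (real n powr \<sigma>) * M_seq \<tau>' \<sigma> n"
      let ?q = "deriv_quot h \<tau> \<sigma> a b f n"
      have v: "0 < ?v" and w: "0 < ?w"
        by (rule weight_pos[OF assms(2)], rule weight_pos[OF assms(3)])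
      \<comment> \<open>Multiplying \<open>?q\<close> by its own weight \<open>?v\<close> recovers
        the unweighted supremum.\<close>
      have "deriv_quot h' \<tau>' \<sigma> a b f n = ?q * ?v / ?w"
        unfolding deriv_quot_def times_divide_eq_left
        by (simp only: nonzero_mult_div_cancel_right[OF less_imp_neq[OF v, symmetric]])
      also have "\<dots> \<le> ?q * A"
        using mult_left_mono[OF A[of n] deriv_quot_nonneg[OF assms(1,2) sm, of \<tau> \<sigma> n]] w
        by (simp only: pos_divide_le_eq mult.assoc)
      also have "\<dots> \<le> A * E_norm h \<tau> \<sigma> a b f"
        using deriv_quot_le_E_norm[OF f, of n] \<open>0 < A\<close> by (simp add: mult.commute)
      finally show ?thesis .
    qed
    \<comment> \<open>Membership has to precede the norm estimate, because \<open>E_norm\<close> has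
      the dummy value 0 outside the space.\<close>
    have "f \<in> E_space h' \<tau>' \<sigma> a b"
      using sm bound by (auto simp: E_space_def intro!: bdd_aboveI)
    with E_norm_least[OF this bound] show ?thesis by blast
  qed
  with \<open>0 < A\<close> show thesis by (rule that)
qed

lemma E_space_subset:
  assumes "a < b" "0 < h" "0 < h'" "\<tau> < \<tau>'"
  shows "(E_space h \<tau> \<sigma> a b :: (real \<Rightarrow> 'k::real_normed_field) set) \<subseteq> E_space h' \<tau>' \<sigma> a b"
  using E_embedding[OF assms, where 'k = 'k] by (metis subsetI)

lemma continuous_map_E_topology:
  assumes "a < b" "0 < h" "0 < h'" "\<tau> < \<tau>'"
  shows "continuous_map (E_topology h \<tau> \<sigma> a b)
           (E_topology h' \<tau>' \<sigma> a b :: (real \<Rightarrow> 'k::real_normed_field) topology) (\<lambda>f. f)"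
proof -
  let ?E = "E_space h \<tau> \<sigma> a b :: (real \<Rightarrow> 'k) set"
  let ?E' = "E_space h' \<tau>' \<sigma> a b :: (real \<Rightarrow> 'k) set"
  interpret X: Metric_space ?E "\<lambda>f g. E_norm h \<tau> \<sigma> a b (\<lambda>x. f x - g x)"
    by (rule E_Metric_space[OF assms(1,2)])
  interpret Y: Metric_space ?E' "\<lambda>f g. E_norm h' \<tau>' \<sigma> a b (\<lambda>x. f x - g x)"
    by (rule E_Metric_space[OF assms(1,3)])
  obtain A where "0 < A" and
    A: "\<And>f. f \<in> ?E \<Longrightarrow> f \<in> ?E' \<and> E_norm h' \<tau>' \<sigma> a b f \<le> A * E_norm h \<tau> \<sigma> a b f"
    using E_embedding[OF assms, where 'k = 'k] by blast
  have "\<exists>r>0. X.mball f r \<subseteq> {f \<in> ?E. f \<in> U}"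
    if U: "openin Y.mtopology U" and f: "f \<in> ?E" "f \<in> U" for U f
  proof -
    obtain r where "0 < r" and r: "Y.mball f r \<subseteq> U"
      using U f(2) unfolding Y.openin_mtopology by blast
    \<comment> \<open>The inclusion stretches distances by at most the factor \<open>A\<close>: the
      norm estimate is applied to the difference of \<open>f\<close> and \<open>g\<close>, which
      lies in \<open>?E\<close> by linearity.\<close>
    have "X.mball f (r / A) \<subseteq> {f \<in> ?E. f \<in> U}"
    proof
      fix g assume "g \<in> X.mball f (r / A)"
      then have g: "g \<in> ?E" and d: "E_norm h \<tau> \<sigma> a b (\<lambda>x. f x - g x) < r / A"
        by (auto simp: X.in_mball)
      have "(\<lambda>x. f x - g x) \<in> ?E"
        using E_lincomb(1)[OF assms(1,2) f(1) g, of 1 "-1"] by simp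
      then have "E_norm h' \<tau>' \<sigma> a b (\<lambda>x. f x - g x) \<le> A * E_norm h \<tau> \<sigma> a b (\<lambda>x. f x - g x)"
        using A by blast
      also have "\<dots> < r"
        using d \<open>0 < A\<close> by (simp add: pos_less_divide_eq mult.commute)
      finally have "g \<in> Y.mball f r"
        using A f(1) g by (simp add: Y.in_mball)
      with r g show "g \<in> {f \<in> ?E. f \<in> U}" by blast
    qed
    with \<open>0 < r\<close> \<open>0 < A\<close> show ?thesis
      by (intro exI[of _ "r / A"]) simp
  qed
  then show ?thesis
    using A unfolding continuous_map_def E_topology_def
    by (auto simp: X.openin_mtopology)
qed

section \<open>Limits along mutually cofinal families\<close>

lemma inductive_limit_candidate_cofinal:
  assumes T: "inductive_limit_candidate V \<S> T"
    and cof: "\<And>S'. S' \<in> \<S>' \<Longrightarrow> \<exists>S\<in>\<S>. continuous_map S' S (\<lambda>f. f)"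
  shows "inductive_limit_candidate V \<S>' T"
proof -
  have "continuous_map S' T (\<lambda>f. f)" if S': "S' \<in> \<S>'" for S'
  proof -
    obtain S where S: "S \<in> \<S>" "continuous_map S' S (\<lambda>f. f)"
      using cof[OF S'] by blast
    have "continuous_map S T (\<lambda>f. f)"
      using T S(1) by (simp add: inductive_limit_candidate_def)
    from continuous_map_compose[OF S(2) this] show ?thesis by (simp add: o_def)
  qed
  with T show ?thesis by (simp add: inductive_limit_candidate_def)
qed

text \<open>Composing inclusions shows that both families admit exactly the same candidate
  topologies, so the two suprema are generated by the same open sets.\<close>

lemma inductive_limit_topology_cofinal:
  assumes "\<And>S. S \<in> \<S> \<Longrightarrow> \<exists>S'\<in>\<S>'. continuous_map S S' (\<lambda>f. f)"
    and "\<And>S'. S' \<in> \<S>' \<Longrightarrow> \<exists>S\<in>\<S>. continuous_map S' S (\<lambda>f. f)"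
  shows "inductive_limit_topology V \<S> = inductive_limit_topology V \<S>'"
proof -
  have "inductive_limit_candidate V \<S> T \<longleftrightarrow> inductive_limit_candidate V \<S>' T" for T
    using inductive_limit_candidate_cofinal[OF _ assms(1), of V T]
      inductive_limit_candidate_cofinal[OF _ assms(2), of V T] by blast
  then show ?thesis
    by (simp add: inductive_limit_topology_def)
qed

text \<open>Every inclusion of \<open>V\<close> into a member of \<open>\<S>\<close> factors through
  a member of \<open>\<S>'\<close>. The limit along \<open>\<S>'\<close> therefore makes all
  inclusions into \<open>\<S>\<close> continuous, and the limit along \<open>\<S>\<close> is the
  coarsest topology doing so.\<close>

lemma projective_limit_topology_finer:
  assumes "\<S> \<noteq> {}" "\<S>' \<noteq> {}"
    and sub: "\<And>S. S \<in> \<S> \<Longrightarrow> V \<subseteq> topspace S" "\<And>S. S \<in> \<S>' \<Longrightarrow> V \<subseteq> topspace S"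
    and cof: "\<And>S. S \<in> \<S> \<Longrightarrow> \<exists>S'\<in>\<S>'. continuous_map S' S (\<lambda>f. f)"
    and "openin (projective_limit_topology V \<S>) U"
  shows "openin (projective_limit_topology V \<S>') U"
proof (rule projective_limit_topology_coarsest(3)[OF assms(1) sub(1)])
  show "topspace (projective_limit_topology V \<S>') = V"
    by (rule projective_limit_topology_coarsest(1)[OF assms(2) sub(2)])
  show "continuous_map (projective_limit_topology V \<S>') S (\<lambda>f. f)" if S: "S \<in> \<S>" for S
  proof -
    obtain S' where "S' \<in> \<S>'" "continuous_map S' S (\<lambda>f. f)"
      using cof[OF S] by blast
    then show ?thesis
      using continuous_map_compose[OF projective_limit_topology_coarsest(2)[OF assms(2) sub(2)]]
      by (fastforce simp: o_def)
  qed
qed (use assms(6) in auto)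

lemma projective_limit_topology_cofinal:
  assumes "\<S> \<noteq> {}" "\<S>' \<noteq> {}"
    and "\<And>S. S \<in> \<S> \<Longrightarrow> V \<subseteq> topspace S" "\<And>S. S \<in> \<S>' \<Longrightarrow> V \<subseteq> topspace S"
    and "\<And>S. S \<in> \<S> \<Longrightarrow> \<exists>S'\<in>\<S>'. continuous_map S' S (\<lambda>f. f)"
    and "\<And>S'. S' \<in> \<S>' \<Longrightarrow> \<exists>S\<in>\<S>. continuous_map S S' (\<lambda>f. f)"
  shows "projective_limit_topology V \<S> = projective_limit_topology V \<S>'"
  unfolding topology_eq
  using projective_limit_topology_finer[of \<S> \<S>' V] projective_limit_topology_finer[of \<S>' \<S> V] assms
  by (metis (no_types, lifting))

section \<open>The equalities of sets and of topologies\<close>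

lemma roumieu_eq:
  assumes "a < b"
  shows "(roumieu \<sigma> a b :: (real \<Rightarrow> 'k::real_normed_field) set) = roumieu_h \<sigma> a b"
proof
  show "(roumieu \<sigma> a b :: (real \<Rightarrow> 'k) set) \<subseteq> roumieu_h \<sigma> a b"
    by (force simp: roumieu_def roumieu_h_def)
  show "(roumieu_h \<sigma> a b :: (real \<Rightarrow> 'k) set) \<subseteq> roumieu \<sigma> a b"
  proof
    fix f :: "real \<Rightarrow> 'k" assume "f \<in> roumieu_h \<sigma> a b"
    then obtain \<tau> h where "0 < \<tau>" "0 < h" "f \<in> E_space h \<tau> \<sigma> a b"
      by (auto simp: roumieu_h_def)
    \<comment> \<open>A union leaves room to enlarge \<open>\<tau>\<close>; any positive increment
      would absorb \<open>h\<close>.\<close>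
    then have "f \<in> E_space 1 (\<tau> + 1) \<sigma> a b"
      using E_space_subset[OF assms, of h 1 \<tau> "\<tau> + 1" \<sigma>, where 'k = 'k] by auto
    with \<open>0 < \<tau>\<close> show "f \<in> roumieu \<sigma> a b"
      by (auto simp: roumieu_def intro!: bexI[of _ "\<tau> + 1"])
  qed
qed

lemma beurling_eq:
  assumes "a < b"
  shows "(beurling \<sigma> a b :: (real \<Rightarrow> 'k::real_normed_field) set) = beurling_h \<sigma> a b"
proof
  show "(beurling_h \<sigma> a b :: (real \<Rightarrow> 'k) set) \<subseteq> beurling \<sigma> a b"
    by (force simp: beurling_def beurling_h_def)
  show "(beurling \<sigma> a b :: (real \<Rightarrow> 'k) set) \<subseteq> beurling_h \<sigma> a b"
  proof
    fix f :: "real \<Rightarrow> 'k" assume f: "f \<in> beurling \<sigma> a b"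
    have "f \<in> E_space h \<tau> \<sigma> a b" if "0 < \<tau>" "0 < h" for \<tau> h
    proof -
      \<comment> \<open>In an intersection the room lies below \<open>\<tau>\<close>:
        \<open>\<tau> / 2\<close> is still positive, and the step from it up to
        \<open>\<tau>\<close> absorbs \<open>h\<close>.\<close>
      have "f \<in> E_space 1 (\<tau> / 2) \<sigma> a b"
        using f that by (simp add: beurling_def)
      then show ?thesis
        using E_space_subset[OF assms, of 1 h "\<tau> / 2" \<tau> \<sigma>, where 'k = 'k] that by auto
    qed
    then show "f \<in> beurling_h \<sigma> a b"
      by (simp add: beurling_h_def)
  qed
qed

lemma roumieu_topology_eq:
  assumes "a < b"
  shows "(roumieu_topology \<sigma> a b :: (real \<Rightarrow> 'k::real_normed_field) topology)
           = roumieu_h_topology \<sigma> a b"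
  \<comment> \<open>Rewriting with the set equality puts both limits on the same underlying space,
    as the cofinality lemma requires.\<close>
  unfolding roumieu_topology_def roumieu_h_topology_def roumieu_eq[OF assms]
proof (rule inductive_limit_topology_cofinal)
  fix S :: "(real \<Rightarrow> 'k) topology" assume "S \<in> {E_topology 1 \<tau> \<sigma> a b | \<tau>. \<tau> > 0}"
  then have "S \<in> {E_topology h \<tau> \<sigma> a b | h \<tau>. h > 0 \<and> \<tau> > 0}"
    using zero_less_one by blast
  then show "\<exists>S'\<in>{E_topology h \<tau> \<sigma> a b | h \<tau>. h > 0 \<and> \<tau> > 0}. continuous_map S S' (\<lambda>f. f)"
    using continuous_map_id[of S, unfolded id_def] by blast
next
  fix S :: "(real \<Rightarrow> 'k) topology" assume "S \<in> {E_topology h \<tau> \<sigma> a b | h \<tau>. h > 0 \<and> \<tau> > 0}"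
  then obtain h \<tau> where S: "S = E_topology h \<tau> \<sigma> a b" and "0 < h" "0 < \<tau>"
    by blast
  then have "continuous_map S (E_topology 1 (\<tau> + 1) \<sigma> a b) (\<lambda>f. f)"
    using continuous_map_E_topology[OF assms, of h 1 \<tau> "\<tau> + 1" \<sigma>] by simp
  moreover have "E_topology 1 (\<tau> + 1) \<sigma> a b \<in> {E_topology 1 \<tau> \<sigma> a b | \<tau>. \<tau> > 0}"
    using \<open>0 < \<tau>\<close> by (auto intro!: exI[of _ "\<tau> + 1"])
  ultimately show "\<exists>S'\<in>{E_topology 1 \<tau> \<sigma> a b | \<tau>. \<tau> > 0}. continuous_map S S' (\<lambda>f. f)"
    by blast
qed

lemma beurling_topology_eq:
  assumes "a < b"
  shows "(beurling_topology \<sigma> a b :: (real \<Rightarrow> 'k::real_normed_field) topology)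
           = beurling_h_topology \<sigma> a b"
  unfolding beurling_topology_def beurling_h_topology_def beurling_eq[OF assms]
proof (rule projective_limit_topology_cofinal)
  let ?\<S> = "{E_topology 1 \<tau> \<sigma> a b | \<tau>. \<tau> > 0} :: (real \<Rightarrow> 'k) topology set"
  let ?\<S>' = "{E_topology h \<tau> \<sigma> a b | h \<tau>. h > 0 \<and> \<tau> > 0} :: (real \<Rightarrow> 'k) topology set"
  have sub: "?\<S> \<subseteq> ?\<S>'"
    using zero_less_one by blast
  have "E_topology 1 1 \<sigma> a b \<in> ?\<S>"
    using zero_less_one by blast
  with sub show "?\<S> \<noteq> {}" "?\<S>' \<noteq> {}"
    by blast+
  show top': "beurling_h \<sigma> a b \<subseteq> topspace S" if "S \<in> ?\<S>'" for S
    using that by (auto simp: beurling_h_def topspace_E_topology[OF assms])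
  show "beurling_h \<sigma> a b \<subseteq> topspace S" if "S \<in> ?\<S>" for S
    using that sub by (intro top') blast
  \<comment> \<open>\<open>S\<close> itself belongs to the larger family (take
    \<open>h = 1\<close>), so the identity serves.\<close>
  show "\<exists>S'\<in>?\<S>'. continuous_map S' S (\<lambda>f. f)" if "S \<in> ?\<S>" for S
    using that sub continuous_map_id[of S, unfolded id_def] by blast
  show "\<exists>S\<in>?\<S>. continuous_map S S' (\<lambda>f. f)" if S'_mem: "S' \<in> ?\<S>'" for S'
  proof -
    obtain h \<tau> where S': "S' = E_topology h \<tau> \<sigma> a b" and "0 < h" "0 < \<tau>"
      using S'_mem by blast
    \<comment> \<open>For projective limits the map must go into \<open>S'\<close>, so the parameter
      is decreased here, whereas the Roumieu case increases it.\<close>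
    then have "continuous_map (E_topology 1 (\<tau> / 2) \<sigma> a b) S' (\<lambda>f. f)"
      using continuous_map_E_topology[OF assms, of 1 h "\<tau> / 2" \<tau> \<sigma>] by simp
    moreover have "E_topology 1 (\<tau> / 2) \<sigma> a b \<in> ?\<S>"
      using \<open>0 < \<tau>\<close> by (auto intro!: exI[of _ "\<tau> / 2"])
    ultimately show ?thesis by blast
  qed
qed

theorem theorem2p5:
  fixes \<sigma> a b :: real
  assumes "\<sigma> > 1" and "a < b"
  shows "(roumieu \<sigma> a b :: (real \<Rightarrow> 'k::real_normed_field) set) = roumieu_h \<sigma> a b
    \<and> (roumieu_topology \<sigma> a b :: (real \<Rightarrow> 'k) topology) = roumieu_h_topology \<sigma> a b
    \<and> (beurling \<sigma> a b :: (real \<Rightarrow> 'k) set) = beurling_h \<sigma> a b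
    \<and> (beurling_topology \<sigma> a b :: (real \<Rightarrow> 'k) topology) = beurling_h_topology \<sigma> a b"
  by (intro conjI roumieu_eq roumieu_topology_eq beurling_eq beurling_topology_eq assms(2))

end
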